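(* Let $A=(\Sigma,Q,\delta,I)$ be a top-down tree automaton. For every downup-relation $W$ on the states of $A$, the relation $P(\sqsubset^{\mathsf{up}}(W),\subseteq^{\mathsf{dw}})$ is good for pruning, where $\sqsubset^{\mathsf{up}}(W)$ is the strict version of the upward simulation preorder $\sqsubseteq^{\mathsf{up}}(W)$ induced by $W$ and $\subseteq^{\mathsf{dw}}$ is the downward trace inclusion preorder on $A$.
   Context: **Trees.** A ranked alphabet $\Sigma$ is a set of symbols with a rank function $\#:\Sigma\to\mathbb N_0$. Nodes are finite sequences of positive integers; $\varepsilon$ is the empty sequence. A tree over $\Sigma$ is a partial map $t$ from nodes to $\Sigma$ with finite nonempty domain such that if $vi\in\mathrm{dom}(t)$ ($i\ge1$) then $v\in\mathrm{dom}(t)$ and $i\le\#(t(v))$. A leaf of $t$ is a node of $\mathrm{dom}(t)$ without children in $\mathrm{dom}(t)$. A tree is closed if every $v\in\mathrm{dom}(t)$ has exactly $\#(t(v))$ children in $\mathrm{dom}(t)$, and open otherwise. $\mathbb T(\Sigma)$ is the set of all trees over $\Sigma$, closed or open. **Automata.** A top-down tree automaton is $A=(\Sigma,Q,\delta,I)$ with $Q$ a finite set of states, $I\subseteq Q$ the initial states, a unique final state $\psi\in Q$ which has no outgoing transitions, and $\delta\subseteq Q\times\Sigma\times Q^+$ a set of transitions, each of the form $\langle q,a,\psi\rangle$ with $\#(a)=0$ or $\langle q,a,q_1\dots q_n\rangle$ with $n=\#(a)\ge1$. A run of $A$ on a tree $t$ (a $t$-run) is a map $\pi$ to $Q$ with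 domain $\mathrm{dom}(t)\cup\{vi: v\in\mathrm{dom}(t),1\le i\le\#(t(v))\}$ such that for every $v\in\mathrm{dom}(t)$: if $\#(t(v))=0$ then $\langle\pi(v),t(v),\psi\rangle\in\delta$, and if $n=\#(t(v))\ge1$ then $\langle\pi(v),t(v),\pi(v1)\dots\pi(vn)\rangle\in\delta$. The language $L(A)$ is the set of closed trees $t$ having a $t$-run $\pi$ with $\pi(\varepsilon)\in I$. **Downward trace inclusion.** $q\subseteq^{\mathsf{dw}}r$ iff for every closed tree $t$ and every $t$-run $\pi_q$ with $\pi_q(\varepsilon)=q$ there is a $t$-run $\pi_r$ with $\pi_r(\varepsilon)=r$ and such that ($\pi_q(v)=\psi\Rightarrow\pi_r(v)=\psi$) for each leaf $v\in\mathrm{dom}(t)$. (In top-down tree automata this coincides with downward language inclusion.) **Upward simulation.** An upward simulation induced by a relation $S$ on $Q$ is a relation $U$ on $Q$ such that $q\,U\,r$ implies ($q=\psi\Rightarrow r=\psi$), ($q\in I\Rightarrow r\in I$), and for every $\langle q',a,q_1\dots q_n\rangle\in\delta$ and $i$ with $q_i=q$ there is $\langle r',a,r_1\dots r_n\rangle\in\delta$ with $r_i=r$, $q'\,U\,r'$ and $q_j\,S\,r_j$ for all $j\ne i$. $\sqsubseteq^{\mathsf{up}}(S)$ is the unique maximal upward simulation induced by $S$ (stated in the source to be a preorder, and called the upward simulation preorder induced by $S$). **Downup-relation.** A relation $W$ on $Q$ is a downup-relation iff the following holds: if $p\,W\,q$, then for every tree $t\in\mathbb T(\Sigma)$ and every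 accepting $t$-run $\pi$ from $p$ there is an accepting $t$-run $\pi'$ from $q$ such that $\pi(v)\sqsubseteq^{\mathsf{up}}(W)\,\pi'(v)$ for all nodes $v$ (at which the runs are defined). Here an accepting $t$-run from a state $s$ is a $t$-run whose root state is $s$, i.e. a run accepting $t$ when started in $s$. **Strict versions and pruning.** The strict version of an order $\le$ is ${\le}\setminus{\le}^{-1}$. For relations $<_{\mathsf u}$ (strict) and $\le_{\mathsf d}$ (non-strict) on $Q$, $P(<_{\mathsf u},\le_{\mathsf d})$ is the set of pairs of transitions $(\langle p,\sigma,r_1\dots r_n\rangle,\langle p',\sigma,r'_1\dots r'_n\rangle)\in\delta\times\delta$ with $p<_{\mathsf u}p'$ and $r_i\le_{\mathsf d}r'_i$ for all $i$. For a strict partial order $P$ on $\delta$, $\mathrm{Prune}(A,P)=(\Sigma,Q,\delta',I)$ where $\delta'$ is the set of $\tau\in\delta$ for which there is no $\tau'\in\delta$ with $\tau\,P\,\tau'$. $P$ is good for pruning iff $L(\mathrm{Prune}(A,P))=L(A)$.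
   Formalization: The maximal upward simulation induced by W is explicitly assumed to be transitive (part of its being a preorder); for an arbitrary downup-relation W it need not be, and then the claim can fail. *)

theory Defs
  imports Main
begin

text \<open>
  A tree is a partial map from nodes to symbols, a node being a list of positive
  numbers; the child \<open>v i\<close> of a node \<open>v\<close> is \<open>v @ [i]\<close>.
  A ranked alphabet is given by a carrier \<open>\<Sigma>\<close> and a rank function \<open>rk\<close>.
\<close>

type_synonym node = "nat list"
type_synonym 'a tree = "node \<rightharpoonup> 'a"

definition trees :: "'a set \<Rightarrow> ('a \<Rightarrow> nat) \<Rightarrow> 'a tree set" where
  "trees \<Sigma> rk = {t. finite (dom t) \<and> dom t \<noteq> {} \<and> ran t \<subseteq> \<Sigma> \<and>
     (\<forall>v\<in>dom t. \<forall>i\<in>set v. 1 \<le> i) \<and>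
     (\<forall>v i. v @ [i] \<in> dom t \<longrightarrow> v \<in> dom t \<and> i \<le> rk (the (t v)))}"

definition leaf :: "'a tree \<Rightarrow> node \<Rightarrow> bool" where
  "leaf t v \<longleftrightarrow> v \<in> dom t \<and> (\<forall>i. v @ [i] \<notin> dom t)"

definition closed_tree :: "('a \<Rightarrow> nat) \<Rightarrow> 'a tree \<Rightarrow> bool" where
  "closed_tree rk t \<longleftrightarrow> (\<forall>v\<in>dom t. card {i. v @ [i] \<in> dom t} = rk (the (t v)))"

type_synonym ('q, 'a) transition = "'q \<times> 'a \<times> 'q list"

record ('q, 'a) automaton =
  alphabet :: "'a set"
  rank :: "'a \<Rightarrow> nat"
  states :: "'q set"
  final :: 'q
  delta :: "('q, 'a) transition set"
  initial :: "'q set"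

definition tdta :: "('q, 'a) automaton \<Rightarrow> bool" where
  "tdta A \<longleftrightarrow> finite (states A) \<and> initial A \<subseteq> states A \<and> final A \<in> states A \<and>
     (\<forall>(q, a, qs)\<in>delta A. q \<in> states A \<and> q \<noteq> final A \<and> a \<in> alphabet A \<and>
        (if rank A a = 0 then qs = [final A]
         else length qs = rank A a \<and> set qs \<subseteq> states A))"

text \<open>
  Runs on open trees also label the missing children of the nodes of the tree.
\<close>

definition run_dom :: "('a \<Rightarrow> nat) \<Rightarrow> 'a tree \<Rightarrow> node set" where
  "run_dom rk t = dom t \<union> {v @ [i] | v i. v \<in> dom t \<and> 1 \<le> i \<and> i \<le> rk (the (t v))}"

definition run :: "('q, 'a) automaton \<Rightarrow> 'a tree \<Rightarrow> (node \<rightharpoonup> 'q) \<Rightarrow> bool" where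
  "run A t \<pi> \<longleftrightarrow> dom \<pi> = run_dom (rank A) t \<and> ran \<pi> \<subseteq> states A \<and>
     (\<forall>v a. t v = Some a \<longrightarrow>
        (if rank A a = 0 then (the (\<pi> v), a, [final A]) \<in> delta A
         else (the (\<pi> v), a, map (\<lambda>i. the (\<pi> (v @ [i]))) [1..<Suc (rank A a)]) \<in> delta A))"

definition run_from :: "('q, 'a) automaton \<Rightarrow> 'a tree \<Rightarrow> 'q \<Rightarrow> (node \<rightharpoonup> 'q) \<Rightarrow> bool" where
  "run_from A t q \<pi> \<longleftrightarrow> run A t \<pi> \<and> \<pi> [] = Some q"

definition lang :: "('q, 'a) automaton \<Rightarrow> 'a tree set" where
  "lang A = {t \<in> trees (alphabet A) (rank A). closed_tree (rank A) t \<and>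
     (\<exists>q\<in>initial A. \<exists>\<pi>. run_from A t q \<pi>)}"

definition dw_incl :: "('q, 'a) automaton \<Rightarrow> 'q rel" where
  "dw_incl A = {(q, r). q \<in> states A \<and> r \<in> states A \<and>
     (\<forall>t\<in>trees (alphabet A) (rank A). closed_tree (rank A) t \<longrightarrow>
       (\<forall>\<pi>. run_from A t q \<pi> \<longrightarrow>
         (\<exists>\<pi>'. run_from A t r \<pi>' \<and>
            (\<forall>v. leaf t v \<longrightarrow> \<pi> v = Some (final A) \<longrightarrow> \<pi>' v = Some (final A)))))}"

definition up_simulation :: "('q, 'a) automaton \<Rightarrow> 'q rel \<Rightarrow> 'q rel \<Rightarrow> bool" where
  "up_simulation A S U \<longleftrightarrow> U \<subseteq> states A \<times> states A \<and>
     (\<forall>(q, r)\<in>U. (q = final A \<longrightarrow> r = final A) \<and> (q \<in> initial A \<longrightarrow> r \<in> initial A) \<and>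
       (\<forall>q' a qs i. (q', a, qs) \<in> delta A \<longrightarrow> i < length qs \<longrightarrow> qs ! i = q \<longrightarrow>
         (\<exists>r' rs. (r', a, rs) \<in> delta A \<and> length rs = length qs \<and> rs ! i = r \<and> (q', r') \<in> U \<and>
            (\<forall>j<length qs. j \<noteq> i \<longrightarrow> (qs ! j, rs ! j) \<in> S))))"

text \<open>The union of all upward simulations, which is the greatest one by the lemmas below.\<close>

definition up_sim :: "('q, 'a) automaton \<Rightarrow> 'q rel \<Rightarrow> 'q rel" where
  "up_sim A S = \<Union> {U. up_simulation A S U}"

lemma up_sim_greatest: "up_simulation A S U \<Longrightarrow> U \<subseteq> up_sim A S"
  by (auto simp: up_sim_def)

lemma up_simulationI:
  assumes "U \<subseteq> states A \<times> states A"
    and "\<And>q r. (q, r) \<in> U \<Longrightarrow> q = final A \<Longrightarrow> r = final A"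
    and "\<And>q r. (q, r) \<in> U \<Longrightarrow> q \<in> initial A \<Longrightarrow> r \<in> initial A"
    and "\<And>q r q' a qs i. (q, r) \<in> U \<Longrightarrow> (q', a, qs) \<in> delta A \<Longrightarrow> i < length qs \<Longrightarrow> qs ! i = q \<Longrightarrow>
      \<exists>r' rs. (r', a, rs) \<in> delta A \<and> length rs = length qs \<and> rs ! i = r \<and> (q', r') \<in> U \<and>
        (\<forall>j<length qs. j \<noteq> i \<longrightarrow> (qs ! j, rs ! j) \<in> S)"
  shows "up_simulation A S U"
  unfolding up_simulation_def case_prod_unfold
  using assms by (metis (no_types, lifting) prod.collapse)

lemma up_simulationD:
  assumes "up_simulation A S U" "(q, r) \<in> U"
  shows "q \<in> states A" "r \<in> states A" "q = final A \<Longrightarrow> r = final A" "q \<in> initial A \<Longrightarrow> r \<in> initial A"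
    and "(q', a, qs) \<in> delta A \<Longrightarrow> i < length qs \<Longrightarrow> qs ! i = q \<Longrightarrow>
      \<exists>r' rs. (r', a, rs) \<in> delta A \<and> length rs = length qs \<and> rs ! i = r \<and> (q', r') \<in> U \<and>
        (\<forall>j<length qs. j \<noteq> i \<longrightarrow> (qs ! j, rs ! j) \<in> S)"
  using assms unfolding up_simulation_def by blast+

lemma up_simulation_up_sim: "up_simulation A S (up_sim A S)"
proof (rule up_simulationI, goal_cases)
  case 1
  then show ?case by (auto simp: up_sim_def up_simulation_def)
next
  case (2 q r)
  then show ?case unfolding up_sim_def by (blast dest: up_simulationD(3))
next
  case (3 q r)
  then show ?case unfolding up_sim_def by (blast dest: up_simulationD(4))
next
  case (4 q r q' a qs i)
  then obtain U where U: "up_simulation A S U" "(q, r) \<in> U"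
    by (auto simp: up_sim_def)
  from up_simulationD(5)[OF U 4(2-4)] up_sim_greatest[OF U(1)] show ?case
    by blast
qed

lemma refl_on_up_sim:
  assumes "refl_on (states A) S" "tdta A"
  shows "refl_on (states A) (up_sim A S)"
proof -
  have st: "q' \<in> states A" "\<forall>j<length qs. qs ! j \<in> states A" if "(q', a, qs) \<in> delta A" for q' a qs
    using assms(2) that unfolding tdta_def by (fastforce split: if_splits simp: subset_iff)+
  have "up_simulation A S (Id_on (states A))"
  proof (rule up_simulationI, goal_cases)
    case (4 q r q' a qs i)
    with st[OF 4(2)] refl_onD[OF assms(1)] show ?case
      by (intro exI[of _ q'] exI[of _ qs]) auto
  qed auto
  from up_sim_greatest[OF this] show ?thesis
    using up_simulation_up_sim[of A S] unfolding refl_on_def by blast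
qed

lemma trans_up_sim:
  assumes "trans S"
  shows "trans (up_sim A S)"
proof -
  note D = up_simulationD[OF up_simulation_up_sim]
  have "up_simulation A S (up_sim A S O up_sim A S)"
  proof (rule up_simulationI, goal_cases)
    case 1
    then show ?case by (auto dest: D(1,2))
  next
    case (2 q r)
    then show ?case by (blast dest: D(3))
  next
    case (3 q r)
    then show ?case by (blast dest: D(4))
  next
    case (4 q s q' a qs i)
    then obtain r where "(q, r) \<in> up_sim A S" and rs: "(r, s) \<in> up_sim A S"
      by blast
    from D(5)[OF this(1) 4(2-4)] obtain r' rs where r: "(r', a, rs) \<in> delta A"
        "length rs = length qs" "rs ! i = r" "(q', r') \<in> up_sim A S"
        "\<forall>j<length qs. j \<noteq> i \<longrightarrow> (qs ! j, rs ! j) \<in> S"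
      by blast
    have "i < length rs" using 4(3) r(2) by simp
    from D(5)[OF rs r(1) this r(3)] obtain s' ss where s: "(s', a, ss) \<in> delta A"
        "length ss = length rs" "ss ! i = s" "(r', s') \<in> up_sim A S"
        "\<forall>j<length rs. j \<noteq> i \<longrightarrow> (rs ! j, ss ! j) \<in> S"
      by blast
    have "\<forall>j<length qs. j \<noteq> i \<longrightarrow> (qs ! j, ss ! j) \<in> S"
      using r(2,5) s(5) transD[OF assms] by metis
    with r s show ?case by (metis relcomp.relcompI)
  qed
  from up_sim_greatest[OF this] show ?thesis by (auto intro: transI)
qed

definition downup_relation :: "('q, 'a) automaton \<Rightarrow> 'q rel \<Rightarrow> bool" where
  "downup_relation A W \<longleftrightarrow> W \<subseteq> states A \<times> states A \<and>
     (\<forall>(p, q)\<in>W. \<forall>t\<in>trees (alphabet A) (rank A). \<forall>\<pi>. run_from A t p \<pi> \<longrightarrow>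
       (\<exists>\<pi>'. run_from A t q \<pi>' \<and>
          (\<forall>v\<in>run_dom (rank A) t. (the (\<pi> v), the (\<pi>' v)) \<in> up_sim A W)))"

definition strict :: "'b rel \<Rightarrow> 'b rel" where
  "strict R = R - R\<inverse>"

definition prune_rel :: "('q, 'a) automaton \<Rightarrow> 'q rel \<Rightarrow> 'q rel \<Rightarrow> ('q, 'a) transition rel" where
  "prune_rel A U D = {((p, a, rs), (p', a', rs')).
     (p, a, rs) \<in> delta A \<and> (p', a', rs') \<in> delta A \<and> a = a' \<and>
     (p, p') \<in> U \<and> list_all2 (\<lambda>r r'. (r, r') \<in> D) rs rs'}"

definition prune :: "('q, 'a) automaton \<Rightarrow> ('q, 'a) transition rel \<Rightarrow> ('q, 'a) automaton" where
  "prune A P = A\<lparr>delta := {\<tau> \<in> delta A. \<not> (\<exists>\<tau>'\<in>delta A. (\<tau>, \<tau>') \<in> P)}\<rparr>"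

definition good_for_pruning :: "('q, 'a) automaton \<Rightarrow> ('q, 'a) transition rel \<Rightarrow> bool" where
  "good_for_pruning A P \<longleftrightarrow> lang (prune A P) = lang A"

lemma trans_dw_incl: "trans (dw_incl A)"
proof (rule transI)
  fix p q r
  assume pq: "(p, q) \<in> dw_incl A" and qr: "(q, r) \<in> dw_incl A"
  have "\<exists>\<pi>'. run_from A t r \<pi>' \<and>
      (\<forall>v. leaf t v \<longrightarrow> \<pi> v = Some (final A) \<longrightarrow> \<pi>' v = Some (final A))"
    if t: "t \<in> trees (alphabet A) (rank A)" "closed_tree (rank A) t" "run_from A t p \<pi>" for t \<pi>
  proof -
    obtain \<rho> where \<rho>: "run_from A t q \<rho>"
        "\<forall>v. leaf t v \<longrightarrow> \<pi> v = Some (final A) \<longrightarrow> \<rho> v = Some (final A)"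
      using pq t unfolding dw_incl_def by blast
    obtain \<pi>' where "run_from A t r \<pi>'"
        "\<forall>v. leaf t v \<longrightarrow> \<rho> v = Some (final A) \<longrightarrow> \<pi>' v = Some (final A)"
      using qr t(1,2) \<rho>(1) unfolding dw_incl_def by blast
    with \<rho>(2) show ?thesis by blast
  qed
  with pq qr show "(p, r) \<in> dw_incl A"
    unfolding dw_incl_def by simp
qed

lemma trans_strict: "trans R \<Longrightarrow> trans (strict R)"
  unfolding trans_def strict_def by blast

text \<open>
  Pruning is meant for strict partial orders. The greatest upward simulation is a preorder if
  the inducing relation is one, but need not even be transitive otherwise; transitivity is
  what makes the following pruning relation a strict partial order.
\<close>

lemma strict_partial_order_prune_rel:
  assumes "trans (up_sim A W)"
  shows "irrefl (prune_rel A (strict (up_sim A W)) (dw_incl A))"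
    and "trans (prune_rel A (strict (up_sim A W)) (dw_incl A))"
proof -
  show "irrefl (prune_rel A (strict (up_sim A W)) (dw_incl A))"
    by (auto simp: irrefl_def prune_rel_def strict_def)
  have *: "list_all2 (\<lambda>r r'. (r, r') \<in> dw_incl A) xs zs"
    if "list_all2 (\<lambda>r r'. (r, r') \<in> dw_incl A) xs ys" "list_all2 (\<lambda>r r'. (r, r') \<in> dw_incl A) ys zs"
    for xs ys zs
    using that unfolding list_all2_conv_all_nth by (metis transD[OF trans_dw_incl])
  show "trans (prune_rel A (strict (up_sim A W)) (dw_incl A))"
  proof (rule transI, clarsimp simp: prune_rel_def, intro conjI, goal_cases)
    case 1
    then show ?case using transD[OF trans_strict[OF assms]] by blast
  next
    case 2
    then show ?case using * by blast
  qed
qed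

end

theory Submission
  imports Defs
begin

text \<open>
  Compare two accepting runs on a tree \<open>t\<close> by the following strict order: the second is above
  the first if it is strictly larger at some node \<open>v\<close> and larger at all nodes that
  are not deeper than \<open>v\<close>, with respect to the upward simulation induced by \<open>W\<close>. Suppose that a
  run uses a pruned transition at \<open>v\<close>. Replace it by a transition that dominates it; downward
  inclusion supplies runs below \<open>v\<close>, upward simulation changes the path from \<open>v\<close> to the root, and
  the subtrees branching off this path are repaired by \<open>W\<close>, which only raises their states.
  All nodes changed without control are deeper than \<open>v\<close>, so the new run is strictly above the old
  one. Hence a maximal accepting run uses no pruned transition.
\<close>

definition subtree :: "(node \<rightharpoonup> 'b) \<Rightarrow> node \<Rightarrow> (node \<rightharpoonup> 'b)" where
  "subtree t v = (\<lambda>w. t (v @ w))"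

definition closed_trees :: "('q, 'a) automaton \<Rightarrow> 'a tree set" where
  "closed_trees A = {t \<in> trees (alphabet A) (rank A). closed_tree (rank A) t}"

text \<open>At a symbol of rank 0 there is no child node to label, yet the transition goes to the
  final state. The default \<open>[final A]\<close> lets one clause of \<open>run_iff\<close> cover
  both kinds of transition.\<close>

definition child_states :: "('q, 'a) automaton \<Rightarrow> (node \<rightharpoonup> 'q) \<Rightarrow> node \<Rightarrow> 'a \<Rightarrow> 'q list" where
  "child_states A \<pi> v a = (if rank A a = 0 then [final A]
     else map (\<lambda>i. the (\<pi> (v @ [i]))) [1..<Suc (rank A a)])"

text \<open>The maps \<open>\<rho> i\<close> come from a choice and are arbitrary when
  \<open>i\<close> is not a child index; testing \<open>t\<close> keeps their stray labels out of
  the glued map.\<close>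

definition node_run :: "'a tree \<Rightarrow> 'q \<Rightarrow> (nat \<Rightarrow> node \<rightharpoonup> 'q) \<Rightarrow> (node \<rightharpoonup> 'q)" where
  "node_run t q \<rho> = (\<lambda>w. case w of [] \<Rightarrow> Some q
     | i # w' \<Rightarrow> if t (i # w') = None then None else \<rho> i w')"

section \<open>Subtrees and closed trees\<close>

lemma subtree_apply [simp]: "subtree t v w = t (v @ w)"
  by (simp add: subtree_def)

lemma subtree_subtree [simp]: "subtree (subtree t u) v = subtree t (u @ v)"
  by (simp add: subtree_def)

lemma trees_prefixD:
  assumes "t \<in> trees \<Sigma> rk" "u @ w \<in> dom t"
  shows "u \<in> dom t"
  using assms(2)
proof (induction w rule: rev_induct)
  case (snoc i w)
  then have "(u @ w) @ [i] \<in> dom t" by simp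
  then have "u @ w \<in> dom t" using assms(1) unfolding trees_def by blast
  then show ?case by (rule snoc.IH)
qed simp

lemma Nil_in_dom_tree:
  assumes "t \<in> trees \<Sigma> rk"
  shows "[] \<in> dom t"
proof -
  obtain v where "v \<in> dom t" using assms unfolding trees_def by blast
  with trees_prefixD[OF assms, of "[]" v] show ?thesis by simp
qed

text \<open>In any tree the child indices of \<open>v\<close> lie in \<open>{1..rank A a}\<close>,
  and closedness fixes their number to \<open>rank A a\<close>. A subset of a finite set with the
  same cardinality is the whole set.\<close>

lemma closed_tree_child_iff:
  assumes t: "t \<in> closed_trees A" and v: "t v = Some a"
  shows "v @ [i] \<in> dom t \<longleftrightarrow> 1 \<le> i \<and> i \<le> rank A a"
proof -
  let ?C = "{i. v @ [i] \<in> dom t}"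
  have tr: "t \<in> trees (alphabet A) (rank A)" and cl: "closed_tree (rank A) t"
    using t by (auto simp: closed_trees_def)
  have "?C \<subseteq> {1..rank A a}"
  proof
    fix i assume "i \<in> ?C"
    then have i: "v @ [i] \<in> dom t" by blast
    have "\<forall>j\<in>set (v @ [i]). 1 \<le> j" using tr i unfolding trees_def by blast
    moreover have "i \<le> rank A (the (t v))" using tr i unfolding trees_def by blast
    ultimately show "i \<in> {1..rank A a}" using v by simp
  qed
  moreover have "v \<in> dom t" using v by blast
  then have "card ?C = rank A (the (t v))" using cl unfolding closed_tree_def by blast
  then have "card ?C = card {1..rank A a}" using v by simp
  ultimately have "?C = {1..rank A a}" by (intro card_subset_eq finite_atLeastAtMost)
  then have "i \<in> ?C \<longleftrightarrow> i \<in> {1..rank A a}" by (rule arg_cong)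
  then show ?thesis by simp
qed

lemma run_dom_closed_tree:
  assumes "t \<in> closed_trees A"
  shows "run_dom (rank A) t = dom t"
proof -
  have "v @ [i] \<in> dom t" if "v \<in> dom t" "1 \<le> i" "i \<le> rank A (the (t v))" for v i
    using that closed_tree_child_iff[OF assms, of v "the (t v)" i] by fastforce
  then show ?thesis unfolding run_dom_def by blast
qed

lemma subtree_closed_trees:
  assumes t: "t \<in> closed_trees A" and v: "v \<in> dom t"
  shows "subtree t v \<in> closed_trees A"
proof -
  have tr: "t \<in> trees (alphabet A) (rank A)" and cl: "closed_tree (rank A) t"
    using t by (auto simp: closed_trees_def)
  have dom: "w \<in> dom (subtree t v) \<longleftrightarrow> v @ w \<in> dom t" for w by (simp add: dom_def)
  have child: "v @ w @ [i] \<in> dom t \<longleftrightarrow> w @ [i] \<in> dom (subtree t v)" for w i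
    using dom[of "w @ [i]"] by simp
  have "finite ((@) v -` dom t)"
    using tr by (intro finite_vimageI) (auto simp: trees_def inj_on_def)
  moreover have "dom (subtree t v) = (@) v -` dom t" using dom by blast
  ultimately have "finite (dom (subtree t v))" by simp
  moreover have "[] \<in> dom (subtree t v)" using v dom by simp
  moreover have "ran (subtree t v) \<subseteq> alphabet A"
    using tr by (auto simp: trees_def ran_def)
  moreover have "\<forall>w\<in>dom (subtree t v). \<forall>i\<in>set w. 1 \<le> i"
  proof (intro ballI)
    fix w i assume "w \<in> dom (subtree t v)" "i \<in> set w"
    then have "v @ w \<in> dom t" "i \<in> set (v @ w)" using dom by auto
    then show "1 \<le> i" using tr unfolding trees_def by blast
  qed
  moreover have "w \<in> dom (subtree t v) \<and> i \<le> rank A (the (subtree t v w))"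
    if "w @ [i] \<in> dom (subtree t v)" for w i
  proof -
    have "(v @ w) @ [i] \<in> dom t" using that dom by simp
    then have "v @ w \<in> dom t \<and> i \<le> rank A (the (t (v @ w)))"
      using tr unfolding trees_def by blast
    then show ?thesis using dom by simp
  qed
  ultimately have "subtree t v \<in> trees (alphabet A) (rank A)"
    unfolding trees_def by blast
  moreover have "closed_tree (rank A) (subtree t v)"
    unfolding closed_tree_def
  proof
    fix w assume "w \<in> dom (subtree t v)"
    then have "v @ w \<in> dom t" using dom by blast
    then have "card {i. (v @ w) @ [i] \<in> dom t} = rank A (the (t (v @ w)))"
      using cl unfolding closed_tree_def by blast
    then show "card {i. w @ [i] \<in> dom (subtree t v)} = rank A (the (subtree t v w))"
      unfolding subtree_apply child[symmetric] append_assoc .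
  qed
  ultimately show ?thesis unfolding closed_trees_def by blast
qed

section \<open>Runs on closed trees: restriction and gluing\<close>

text \<open>Children are numbered from 1 but list positions from 0; this is the source of every
  \<open>i - 1\<close> below.\<close>

lemma child_states_nth:
  assumes "1 \<le> i" "i \<le> rank A a"
  shows "child_states A \<pi> v a ! (i - 1) = the (\<pi> (v @ [i]))"
proof -
  have "[1..<Suc (rank A a)] ! (i - 1) = i"
    using assms nth_upt[of 1 "i - 1" "Suc (rank A a)"] by (simp del: upt_Suc)
  then show ?thesis using assms by (simp add: child_states_def del: upt_Suc)
qed

lemma length_child_states: "rank A a \<noteq> 0 \<Longrightarrow> length (child_states A \<pi> v a) = rank A a"
  by (simp add: child_states_def)

lemma child_states_prune [simp]: "child_states (prune A P) = child_states A"
  by (intro ext) (simp add: child_states_def prune_def)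

lemma child_states_subtree: "child_states A (subtree \<pi> u) w a = child_states A \<pi> (u @ w) a"
  by (simp add: child_states_def)

lemma run_iff: "run A t \<pi> \<longleftrightarrow> dom \<pi> = run_dom (rank A) t \<and> ran \<pi> \<subseteq> states A \<and>
    (\<forall>v a. t v = Some a \<longrightarrow> (the (\<pi> v), a, child_states A \<pi> v a) \<in> delta A)"
proof -
  have "(the (\<pi> v), a, child_states A \<pi> v a) \<in> delta A \<longleftrightarrow>
      (if rank A a = 0 then (the (\<pi> v), a, [final A]) \<in> delta A
       else (the (\<pi> v), a, map (\<lambda>i. the (\<pi> (v @ [i]))) [1..<Suc (rank A a)]) \<in> delta A)" for v a
    by (simp add: child_states_def del: upt_Suc)
  then show ?thesis unfolding run_def by presburger
qed

lemma run_closed_tree_iff: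
  assumes "t \<in> closed_trees A"
  shows "run A t \<pi> \<longleftrightarrow> dom \<pi> = dom t \<and> ran \<pi> \<subseteq> states A \<and>
    (\<forall>v a. t v = Some a \<longrightarrow> (the (\<pi> v), a, child_states A \<pi> v a) \<in> delta A)"
  unfolding run_iff run_dom_closed_tree[OF assms] ..

lemma dom_run:
  assumes "t \<in> closed_trees A" "run A t \<pi>"
  shows "dom \<pi> = dom t"
  using assms(2) unfolding run_closed_tree_iff[OF assms(1)] ..

lemma run_subtree:
  assumes t: "t \<in> closed_trees A" and v: "v \<in> dom t" and \<pi>: "run A t \<pi>"
  shows "run A (subtree t v) (subtree \<pi> v)"
proof -
  note \<pi> = \<pi>[unfolded run_closed_tree_iff[OF t]]
  have "w \<in> dom (subtree \<pi> v) \<longleftrightarrow> w \<in> dom (subtree t v)" for w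
  proof -
    have "v @ w \<in> dom \<pi> \<longleftrightarrow> v @ w \<in> dom t" using \<pi> by blast
    then show ?thesis by (simp add: dom_def)
  qed
  then have "dom (subtree \<pi> v) = dom (subtree t v)" by blast
  moreover have "ran (subtree \<pi> v) \<subseteq> ran \<pi>" by (auto simp: ran_def)
  ultimately show ?thesis
    using \<pi> unfolding run_closed_tree_iff[OF subtree_closed_trees[OF t v]]
    by (auto simp: child_states_subtree)
qed

text \<open>Every new run below is glued by this lemma: at a pruned node from the dominating
  transition, at its ancestors from the transitions that upward simulation supplies. The run
  condition is local, so at the root it is \<open>\<delta>\<close> and elsewhere it is inherited
  from some \<open>\<rho> i\<close>.\<close>

lemma run_from_node_run:
  assumes A: "tdta A" and t: "t \<in> closed_trees A" and a: "t [] = Some a"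
    and \<delta>: "(q, a, qs) \<in> delta A"
    and \<rho>: "\<And>i. 1 \<le> i \<Longrightarrow> i \<le> rank A a \<Longrightarrow> run_from A (subtree t [i]) (qs ! (i - 1)) (\<rho> i)"
  shows "run_from A t q (node_run t q \<rho>)"
proof -
  let ?\<pi> = "node_run t q \<rho>"
  have tr: "t \<in> trees (alphabet A) (rank A)" using t by (simp add: closed_trees_def)
  have child: "[i] \<in> dom t \<longleftrightarrow> 1 \<le> i \<and> i \<le> rank A a" for i
    using closed_tree_child_iff[OF t a, of i] by simp
  have head: "[i] \<in> dom t" if "i # w \<in> dom t" for i w
    using trees_prefixD[OF tr, of "[i]" w] that by simp
  have sub: "run A (subtree t [i]) (\<rho> i)" "\<rho> i [] = Some (qs ! (i - 1))" if "[i] \<in> dom t" for i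
    using \<rho>[of i] that child by (auto simp: run_from_def)
  have cl: "subtree t [i] \<in> closed_trees A" if "[i] \<in> dom t" for i
    using subtree_closed_trees[OF t that] .
  have sub_run: "dom (\<rho> i) = dom (subtree t [i])" "ran (\<rho> i) \<subseteq> states A"
    "\<And>v b. t (i # v) = Some b \<Longrightarrow> (the (\<rho> i v), b, child_states A (\<rho> i) v b) \<in> delta A"
    if "[i] \<in> dom t" for i
    using sub(1)[OF that] unfolding run_closed_tree_iff[OF cl[OF that]] by auto
  \<comment> \<open>At a genuine child the test in \<open>node_run\<close> changes nothing, since
    \<open>\<rho> i\<close> is itself undefined outside the subtree.\<close>
  have \<pi>: "?\<pi> (i # w) = \<rho> i w" if "[i] \<in> dom t" for i w
  proof (cases "t (i # w)")
    case None
    then have "w \<notin> dom (\<rho> i)" unfolding sub_run(1)[OF that] by (simp add: domIff)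
    then have "\<rho> i w = None" by (simp add: domIff)
    with None show ?thesis by (simp add: node_run_def)
  qed (simp add: node_run_def)
  have "(v \<in> dom ?\<pi>) = (v \<in> dom t)" for v
  proof (cases v)
    case Nil
    with a show ?thesis by (auto simp: node_run_def)
  next
    case (Cons i w)
    show ?thesis
    proof (cases "[i] \<in> dom t")
      case True
      have "w \<in> dom (\<rho> i) \<longleftrightarrow> w \<in> dom (subtree t [i])" using sub_run(1)[OF True] by blast
      then show ?thesis using Cons \<pi>[OF True, of w] by (simp add: dom_def)
    next
      case False
      with head have "i # w \<notin> dom t" by blast
      then show ?thesis using Cons by (auto simp: node_run_def dom_def)
    qed
  qed
  then have "dom ?\<pi> = dom t" by blast
  moreover have "ran ?\<pi> \<subseteq> states A"
  proof
    fix s assume "s \<in> ran ?\<pi>"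
    then obtain v where v: "?\<pi> v = Some s" by (auto simp: ran_def)
    show "s \<in> states A"
    proof (cases v)
      case Nil
      with v \<delta> A show ?thesis by (auto simp: node_run_def tdta_def)
    next
      case (Cons i w)
      then have i: "[i] \<in> dom t" using v head[of i w]
        by (auto simp: node_run_def split: if_splits)
      then have "\<rho> i w = Some s" using \<pi>[OF i] Cons v by simp
      then show ?thesis using sub_run(2)[OF i] by (auto intro: ranI)
    qed
  qed
  moreover have "(the (?\<pi> v), b, child_states A ?\<pi> v b) \<in> delta A" if b: "t v = Some b" for v b
  proof (cases v)
    case Nil
    then have ab: "b = a" using a b by simp
    have "child_states A ?\<pi> [] a = qs"
    proof (cases "rank A a = 0")
      case True
      \<comment> \<open>Well-formedness of \<open>A\<close> forces \<open>qs = [final A]\<close>,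
        which is the default value of \<open>child_states\<close>.\<close>
      then show ?thesis using A \<delta> by (auto simp: tdta_def child_states_def)
    next
      case False
      then have len: "length qs = rank A a" using A \<delta> by (auto simp: tdta_def)
      show ?thesis
      proof (rule nth_equalityI)
        fix k assume "k < length (child_states A ?\<pi> [] a)"
        then have k: "1 \<le> Suc k" "Suc k \<le> rank A a"
          using length_child_states[of A a ?\<pi> "[]"] False by auto
        then have i: "[Suc k] \<in> dom t" using child by blast
        have "child_states A ?\<pi> [] a ! k = the (?\<pi> [Suc k])"
          using child_states_nth[OF k, of ?\<pi> "[]"] by simp
        also have "\<dots> = qs ! k" using \<pi>[OF i, of "[]"] sub(2)[OF i] by simp
        finally show "child_states A ?\<pi> [] a ! k = qs ! k" .
      qed (simp add: length_child_states False len)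
    qed
    then show ?thesis using Nil ab \<delta> by (simp add: node_run_def)
  next
    case (Cons i w)
    then have i: "[i] \<in> dom t" using head b by blast
    have "child_states A ?\<pi> (i # w) b = child_states A (\<rho> i) w b"
      using \<pi>[OF i] by (simp add: child_states_def)
    then show ?thesis using sub_run(3)[OF i] b Cons \<pi>[OF i] by simp
  qed
  ultimately have "run A t ?\<pi>" by (simp only: run_closed_tree_iff[OF t]) blast
  then show ?thesis by (simp add: run_from_def node_run_def)
qed

section \<open>Raising a run along the path to the root\<close>

text \<open>Climb from \<open>v\<close> to the root. At a parent \<open>u\<close>, upward simulation
  offers a transition that reaches \<open>p\<close> at the child on the path and
  \<open>W\<close>-larger states at its siblings. The downup property turns the latter into
  pointwise larger runs on the sibling subtrees; glue everything at \<open>u\<close> and continue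
  from there.\<close>

lemma raise_run:
  assumes A: "tdta A" and W: "downup_relation A W" and t: "t \<in> closed_trees A"
    and \<pi>: "run A t \<pi>" and v: "v \<in> dom t" and p: "(the (\<pi> v), p) \<in> up_sim A W"
    and \<rho>: "run_from A (subtree t v) p \<rho>"
  shows "\<exists>\<pi>'. run A t \<pi>' \<and> (\<forall>w. \<pi>' (v @ w) = \<rho> w) \<and>
    (\<forall>w\<in>dom t. (\<nexists>x. w = v @ x) \<longrightarrow> (the (\<pi> w), the (\<pi>' w)) \<in> up_sim A W)"
  using v p \<rho>
\<comment> \<open>Reverse induction removes the last index and so passes from a node to its parent.
  The state and the run below it are general because the parent receives new ones.\<close>
proof (induction v arbitrary: p \<rho> rule: rev_induct)
  case Nil
  then show ?case by (intro exI[of _ \<rho>]) (simp add: run_from_def subtree_def)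
next
  case (snoc i u)
  have tr: "t \<in> trees (alphabet A) (rank A)" using t by (simp add: closed_trees_def)
  have u: "u \<in> dom t" using trees_prefixD[OF tr snoc.prems(1)] .
  then obtain a where a: "t u = Some a" by blast
  note child = closed_tree_child_iff[OF t a]
  have i: "1 \<le> i" "i \<le> rank A a" using snoc.prems(1) child by auto
  define qs where "qs = child_states A \<pi> u a"
  have len: "length qs = rank A a" using i by (simp add: qs_def length_child_states)
  have qs: "qs ! (j - 1) = the (\<pi> (u @ [j]))" if "1 \<le> j" "j \<le> rank A a" for j
    unfolding qs_def using child_states_nth[OF that] .
  have "(the (\<pi> u), a, qs) \<in> delta A"
    using \<pi> a unfolding run_iff qs_def by blast
  moreover have "i - 1 < length qs" using i len by simp
  \<comment> \<open>Upward simulation is applied at position \<open>i - 1\<close>, that of the child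
    \<open>u @ [i]\<close>. Since it is induced by \<open>W\<close>, the remaining targets are
    compared by \<open>W\<close>.\<close>
  ultimately
  obtain r rs where r: "(r, a, rs) \<in> delta A" "length rs = length qs" "rs ! (i - 1) = p"
      "(the (\<pi> u), r) \<in> up_sim A W" "\<forall>j<length qs. j \<noteq> i - 1 \<longrightarrow> (qs ! j, rs ! j) \<in> W"
    using up_simulationD(5)[OF up_simulation_up_sim snoc.prems(2) _ _ qs[OF i]] by blast
  \<comment> \<open>The given \<open>\<rho>\<close> is kept below child \<open>i\<close>, and
    siblings get a run above the old one. One statement for both cases allows a single choice of
    \<open>\<sigma>\<close>.\<close>
  have "\<exists>\<sigma>. run_from A (subtree t (u @ [j])) (rs ! (j - 1)) \<sigma> \<and>
      (if j = i then \<sigma> = \<rho> else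
       \<forall>w\<in>dom (subtree t (u @ [j])). (the (\<pi> (u @ [j] @ w)), the (\<sigma> w)) \<in> up_sim A W)"
    if j: "1 \<le> j" "j \<le> rank A a" for j
  proof (cases "j = i")
    case True
    then have "run_from A (subtree t (u @ [j])) (rs ! (j - 1)) \<rho>"
      using snoc.prems(3) r(3) by (simp only:)
    with True show ?thesis by auto
  next
    case False
    have uj: "u @ [j] \<in> dom t" using child j by blast
    let ?t = "subtree t (u @ [j])"
    have tj: "?t \<in> closed_trees A" using subtree_closed_trees[OF t uj] .
    have "dom \<pi> = dom t" using dom_run[OF t \<pi>] .
    with uj have "u @ [j] \<in> dom \<pi>" by simp
    then have "run_from A ?t (qs ! (j - 1)) (subtree \<pi> (u @ [j]))"
      using run_subtree[OF t uj \<pi>] qs[OF j] by (auto simp: run_from_def)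
    \<comment> \<open>Both indices are at least 1, so \<open>j \<noteq> i\<close> survives the
      truncated subtraction.\<close>
    moreover have "(qs ! (j - 1), rs ! (j - 1)) \<in> W"
      using r(5) j i False len by auto
    moreover have "?t \<in> trees (alphabet A) (rank A)" using tj by (simp add: closed_trees_def)
    ultimately obtain \<sigma> where "run_from A ?t (rs ! (j - 1)) \<sigma>"
        "\<forall>w\<in>run_dom (rank A) ?t. (the (subtree \<pi> (u @ [j]) w), the (\<sigma> w)) \<in> up_sim A W"
      using W unfolding downup_relation_def by blast
    then show ?thesis using False run_dom_closed_tree[OF tj] by auto
  qed
  then obtain \<sigma> where \<sigma>: "\<And>j. 1 \<le> j \<Longrightarrow> j \<le> rank A a \<Longrightarrow>
      run_from A (subtree t (u @ [j])) (rs ! (j - 1)) (\<sigma> j) \<and>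
      (if j = i then \<sigma> j = \<rho> else
       \<forall>w\<in>dom (subtree t (u @ [j])). (the (\<pi> (u @ [j] @ w)), the (\<sigma> j w)) \<in> up_sim A W)"
    by metis
  define \<rho>' where "\<rho>' = node_run (subtree t u) r \<sigma>"
  have "run_from A (subtree t u) r \<rho>'"
    unfolding \<rho>'_def
    by (rule run_from_node_run[OF A subtree_closed_trees[OF t u] _ r(1)]) (use a \<sigma> in auto)
  from snoc.IH[OF u r(4) this] obtain \<pi>' where \<pi>': "run A t \<pi>'" "\<And>w. \<pi>' (u @ w) = \<rho>' w"
      "\<And>w. w \<in> dom t \<Longrightarrow> (\<nexists>x. w = u @ x) \<Longrightarrow> (the (\<pi> w), the (\<pi>' w)) \<in> up_sim A W"
    by blast
  have "\<pi>' ((u @ [i]) @ w) = \<rho> w" for w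
  proof (cases "t (u @ i # w)")
    \<comment> \<open>Outside the tree both sides are \<open>None\<close>: the left by the test in
      \<open>node_run\<close>, the right by the domain of \<open>\<rho>\<close>.\<close>
    case None
    have "dom \<rho> = dom (subtree t (u @ [i]))"
      using snoc.prems(3) dom_run[OF subtree_closed_trees[OF t snoc.prems(1)]]
      unfolding run_from_def by blast
    with None have "w \<notin> dom \<rho>" by (simp add: domIff)
    then have "\<rho> w = None" by (simp add: domIff)
    then show ?thesis using None \<pi>'(2)[of "i # w"] by (simp add: \<rho>'_def node_run_def)
  next
    case (Some b)
    then show ?thesis using \<pi>'(2)[of "i # w"] \<sigma>[OF i] by (auto simp: \<rho>'_def node_run_def)
  qed
  moreover have "(the (\<pi> w), the (\<pi>' w)) \<in> up_sim A W"
    if w: "w \<in> dom t" and neq: "\<nexists>x. w = (u @ [i]) @ x" for w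
  \<comment> \<open>Nodes not below \<open>u\<close> are settled by the induction hypothesis,
    \<open>u\<close> itself by upward simulation, and all others lie below a sibling
    \<open>j \<noteq> i\<close>, where \<open>\<sigma> j\<close> is above the old run.\<close>
  proof (cases "\<exists>x. w = u @ x")
    case False
    then show ?thesis using \<pi>'(3) w by blast
  next
    case True
    then obtain x where x: "w = u @ x" by blast
    show ?thesis
    proof (cases x)
      case Nil
      then show ?thesis using x r(4) \<pi>'(2)[of "[]"] by (simp add: \<rho>'_def node_run_def)
    next
      case (Cons j y)
      then have "j \<noteq> i" using neq x by auto
      have "(u @ [j]) @ y \<in> dom t" using w x Cons by simp
      from trees_prefixD[OF tr this] have "1 \<le> j" "j \<le> rank A a" using child by auto
      from \<sigma>[OF this] \<open>j \<noteq> i\<close> show ?thesis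
        using w x Cons \<pi>'(2)[of x] by (auto simp: \<rho>'_def node_run_def)
    qed
  qed
  ultimately show ?case using \<pi>'(1) by blast
qed

section \<open>A strict order on runs\<close>

definition run_less :: "'q rel \<Rightarrow> (node \<rightharpoonup> 'q) rel" where
  "run_less U = {(\<pi>, \<pi>'). \<exists>v\<in>dom \<pi>. (the (\<pi> v), the (\<pi>' v)) \<in> strict U \<and>
     (\<forall>w\<in>dom \<pi>. length w \<le> length v \<longrightarrow> (the (\<pi> w), the (\<pi>' w)) \<in> U)}"

lemma irrefl_run_less: "irrefl (run_less U)"
  by (auto simp: irrefl_def run_less_def strict_def)

text \<open>Depths are linearly ordered, so the shallower of the two witnessing nodes serves: up to
  its depth both comparisons hold. Equal domains make both of them range over the same
  nodes.\<close>

lemma run_less_trans: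
  assumes U: "trans U" and dom: "dom \<pi> = dom \<pi>'"
    and "(\<pi>, \<pi>') \<in> run_less U" "(\<pi>', \<pi>'') \<in> run_less U"
  shows "(\<pi>, \<pi>'') \<in> run_less U"
proof -
  \<comment> \<open>If \<open>(z, x)\<close> were in \<open>U\<close>, transitivity would reverse
    the strict step.\<close>
  have mixed: "(x, y) \<in> strict U \<Longrightarrow> (y, z) \<in> U \<Longrightarrow> (x, z) \<in> strict U"
    "(x, y) \<in> U \<Longrightarrow> (y, z) \<in> strict U \<Longrightarrow> (x, z) \<in> strict U" for x y z
    using U unfolding strict_def by (blast dest: transD)+
  obtain v where v: "v \<in> dom \<pi>" "(the (\<pi> v), the (\<pi>' v)) \<in> strict U"
    "\<And>w. w \<in> dom \<pi> \<Longrightarrow> length w \<le> length v \<Longrightarrow> (the (\<pi> w), the (\<pi>' w)) \<in> U"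
    using assms(3) unfolding run_less_def by blast
  obtain v' where v': "v' \<in> dom \<pi>" "(the (\<pi>' v'), the (\<pi>'' v')) \<in> strict U"
    "\<And>w. w \<in> dom \<pi> \<Longrightarrow> length w \<le> length v' \<Longrightarrow> (the (\<pi>' w), the (\<pi>'' w)) \<in> U"
    using assms(4) dom unfolding run_less_def by blast
  show ?thesis
  proof (cases "length v \<le> length v'")
    case True
    have "(the (\<pi> v), the (\<pi>'' v)) \<in> strict U" using mixed(1) v v'(3) True by blast
    moreover have "\<forall>w\<in>dom \<pi>. length w \<le> length v \<longrightarrow> (the (\<pi> w), the (\<pi>'' w)) \<in> U"
      using v(3) v'(3) True transD[OF U] by (meson le_trans)
    ultimately show ?thesis using v(1) unfolding run_less_def by blast
  next
    case False
    then have le: "length v' \<le> length v" by simp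
    have "(the (\<pi> v'), the (\<pi>'' v')) \<in> strict U" using mixed(2) v(3) v' le by blast
    moreover have "\<forall>w\<in>dom \<pi>. length w \<le> length v' \<longrightarrow> (the (\<pi> w), the (\<pi>'' w)) \<in> U"
      using v(3) v'(3) le transD[OF U] by (meson le_trans)
    ultimately show ?thesis using v'(1) unfolding run_less_def by blast
  qed
qed

section \<open>Improving a run that uses a pruned transition\<close>

lemma pruned_run_not_maximal:
  assumes A: "tdta A" and W: "downup_relation A W" and t: "t \<in> closed_trees A"
    and \<pi>: "run A t \<pi>" and init: "the (\<pi> []) \<in> initial A"
    and notprune: "\<not> run (prune A (prune_rel A (strict (up_sim A W)) (dw_incl A))) t \<pi>"
  shows "\<exists>\<pi>'. run A t \<pi>' \<and> the (\<pi>' []) \<in> initial A \<and> (\<pi>, \<pi>') \<in> run_less (up_sim A W)"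
proof -
  let ?P = "prune_rel A (strict (up_sim A W)) (dw_incl A)"
  have run: "dom \<pi> = run_dom (rank A) t" "ran \<pi> \<subseteq> states A"
    "\<And>v a. t v = Some a \<Longrightarrow> (the (\<pi> v), a, child_states A \<pi> v a) \<in> delta A"
    using \<pi> unfolding run_iff by blast+
  have "rank (prune A ?P) = rank A" "states (prune A ?P) = states A"
    by (simp_all add: prune_def)
  \<comment> \<open>Pruning changes only the transitions, so a run can fail in the pruned automaton
    only at a node whose transition was removed.\<close>
  then have "\<exists>v a. t v = Some a \<and> (the (\<pi> v), a, child_states A \<pi> v a) \<notin> delta (prune A ?P)"
    using notprune run(1,2) unfolding run_iff child_states_prune by simp
  then obtain v a where a: "t v = Some a" "(the (\<pi> v), a, child_states A \<pi> v a) \<notin> delta (prune A ?P)"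
    by blast
  \<comment> \<open>A removed transition is dominated by one of \<open>delta A\<close>. That one may
    itself be pruned, which is harmless: the new run need only be a run of \<open>A\<close>.\<close>
  with run(3)[OF a(1)] obtain p rs where p: "(p, a, rs) \<in> delta A"
      "(the (\<pi> v), p) \<in> strict (up_sim A W)"
      "list_all2 (\<lambda>r r'. (r, r') \<in> dw_incl A) (child_states A \<pi> v a) rs"
    by (auto simp: prune_def prune_rel_def)
  have v: "v \<in> dom t" using a by blast
  have dom: "dom \<pi> = dom t" using dom_run[OF t \<pi>] .
  \<comment> \<open>Downward inclusion carries the old run on each child subtree to a run from the
    new target. The upward simulation does not compare these two runs.\<close>
  have "\<exists>\<sigma>. run_from A (subtree t (v @ [i])) (rs ! (i - 1)) \<sigma>"
    if i: "1 \<le> i" "i \<le> rank A a" for i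
  proof -
    have vi: "v @ [i] \<in> dom t" using closed_tree_child_iff[OF t a(1)] i by blast
    then have "v @ [i] \<in> dom \<pi>" using dom by simp
    then have "run_from A (subtree t (v @ [i])) (the (\<pi> (v @ [i]))) (subtree \<pi> (v @ [i]))"
      using run_subtree[OF t vi \<pi>] by (auto simp: run_from_def)
    moreover have "i - 1 < length (child_states A \<pi> v a)"
      using i by (simp add: length_child_states)
    then have "(the (\<pi> (v @ [i])), rs ! (i - 1)) \<in> dw_incl A"
      using list_all2_nthD[OF p(3)] child_states_nth[OF i, of \<pi> v] by metis
    ultimately show ?thesis
      using subtree_closed_trees[OF t vi] unfolding dw_incl_def closed_trees_def by blast
  qed
  then obtain \<sigma> where "\<And>i. 1 \<le> i \<Longrightarrow> i \<le> rank A a \<Longrightarrow>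
      run_from A (subtree t (v @ [i])) (rs ! (i - 1)) (\<sigma> i)"
    by metis
  then have \<rho>: "run_from A (subtree t v) p (node_run (subtree t v) p \<sigma>)"
    by (intro run_from_node_run[OF A subtree_closed_trees[OF t v] _ p(1)]) (use a in auto)
  have up: "(the (\<pi> v), p) \<in> up_sim A W" using p(2) by (simp add: strict_def)
  from raise_run[OF A W t \<pi> v up \<rho>]
  obtain \<pi>' where \<pi>': "run A t \<pi>'" "\<And>w. \<pi>' (v @ w) = node_run (subtree t v) p \<sigma> w"
      "\<And>w. w \<in> dom t \<Longrightarrow> (\<nexists>x. w = v @ x) \<Longrightarrow> (the (\<pi> w), the (\<pi>' w)) \<in> up_sim A W"
    by blast
  have "\<pi>' v = Some p" using \<pi>'(2)[of "[]"] by (simp add: node_run_def)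
  then have le: "(the (\<pi> w), the (\<pi>' w)) \<in> up_sim A W"
    if "w \<in> dom t" "length w \<le> length v" for w
  proof (cases "w = v")
    case True
    then show ?thesis using up \<open>\<pi>' v = Some p\<close> by simp
  next
    case False
    \<comment> \<open>A proper extension of \<open>v\<close> is deeper than \<open>v\<close>, so
      \<open>w\<close> lies in the region that \<open>raise_run\<close> controls.\<close>
    then have "\<nexists>x. w = v @ x" using that(2) by auto
    then show ?thesis by (rule \<pi>'(3)[OF that(1)])
  qed
  have up_strict: "(the (\<pi> v), the (\<pi>' v)) \<in> strict (up_sim A W)"
    using p(2) \<open>\<pi>' v = Some p\<close> by simp
  have "(\<pi>, \<pi>') \<in> run_less (up_sim A W)"
    unfolding run_less_def mem_Collect_eq prod.case dom
    using v le up_strict by blast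
  moreover have "[] \<in> dom t" using t Nil_in_dom_tree unfolding closed_trees_def by blast
  \<comment> \<open>The root is never deeper than \<open>v\<close>, so it is raised too, and upward
    simulation preserves initial states.\<close>
  then have "(the (\<pi> []), the (\<pi>' [])) \<in> up_sim A W" using le by simp
  then have "the (\<pi>' []) \<in> initial A"
    by (rule up_simulationD(4)[OF up_simulation_up_sim _ init])
  ultimately show ?thesis using \<pi>'(1) by blast
qed

section \<open>Equality of the languages\<close>

lemma lang_prune_subset: "lang (prune A P) \<subseteq> lang A"
proof -
  have "run A t \<pi>" if "run (prune A P) t \<pi>" for t \<pi>
    using that unfolding run_iff child_states_prune by (simp add: prune_def)
  then show ?thesis unfolding lang_def run_from_def prune_def by fastforce
qed

theorem theorem3:
  fixes A :: "('q, 'a) automaton" and W :: "'q rel"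
  assumes "tdta A"
    and "downup_relation A W"
    and "trans (up_sim A W)"
  shows "good_for_pruning A (prune_rel A (strict (up_sim A W)) (dw_incl A))"
proof -
  let ?P = "prune_rel A (strict (up_sim A W)) (dw_incl A)"
  have "t \<in> lang (prune A ?P)" if "t \<in> lang A" for t
  proof -
    have t: "t \<in> closed_trees A" using that by (simp add: lang_def closed_trees_def)
    \<comment> \<open>The accepting runs of \<open>A\<close> on \<open>t\<close> are maps between
      finite sets, hence finitely many, and there is at least one; so a maximal one exists.\<close>
    define R where "R = {\<pi>. run A t \<pi> \<and> the (\<pi> []) \<in> initial A}"
    let ?L = "run_less (up_sim A W)"
    have dom: "dom \<pi> = dom t" "ran \<pi> \<subseteq> states A" if "\<pi> \<in> R" for \<pi>
      using that unfolding R_def run_closed_tree_iff[OF t] by simp_all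
    have "finite (dom t)" using t unfolding closed_trees_def trees_def by blast
    moreover have "finite (states A)" using assms(1) unfolding tdta_def by blast
    ultimately have "finite {\<pi>. dom \<pi> = dom t \<and> ran \<pi> \<subseteq> states A}"
      by (rule finite_set_of_finite_maps)
    then have fin: "finite R" by (rule rev_finite_subset) (use dom in blast)
    have "R \<noteq> {}"
    proof -
      obtain q \<pi> where "q \<in> initial A" "run A t \<pi>" "\<pi> [] = Some q"
        using \<open>t \<in> lang A\<close> unfolding lang_def run_from_def by blast
      then have "\<pi> \<in> R" by (simp add: R_def)
      then show ?thesis by blast
    qed
    \<comment> \<open>\<open>run_less_trans\<close> asks for equal domains, which members of
      \<open>R\<close> share; hence the order properties are stated relative to
      \<open>R\<close>.\<close>
    have less_trans: "(\<pi>, \<pi>'') \<in> ?L"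
      if "\<pi> \<in> R" "\<pi>' \<in> R" "(\<pi>, \<pi>') \<in> ?L" "(\<pi>', \<pi>'') \<in> ?L" for \<pi> \<pi>' \<pi>''
      by (rule run_less_trans[OF assms(3) _ that(3,4)]) (simp add: dom(1) that(1,2))
    have "transp_on R (\<lambda>\<pi> \<pi>'. (\<pi>, \<pi>') \<in> ?L)"
      by (rule transp_onI) (rule less_trans)
    moreover have "asymp_on R (\<lambda>\<pi> \<pi>'. (\<pi>, \<pi>') \<in> ?L)"
    proof (rule asymp_onI, rule notI)
      fix \<pi> \<pi>' assume "\<pi> \<in> R" "\<pi>' \<in> R" "(\<pi>, \<pi>') \<in> ?L" "(\<pi>', \<pi>) \<in> ?L"
      then have "(\<pi>, \<pi>) \<in> ?L" by (rule less_trans)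
      then show False using irreflD[OF irrefl_run_less] by blast
    qed
    ultimately have "\<exists>\<pi>\<in>R. \<forall>\<pi>'\<in>R. \<pi>' \<noteq> \<pi> \<longrightarrow> (\<pi>, \<pi>') \<notin> ?L"
      using Finite_Set.bex_max_element[of R "\<lambda>\<pi> \<pi>'. (\<pi>, \<pi>') \<in> ?L"] fin \<open>R \<noteq> {}\<close> by simp
    then obtain \<pi> where \<pi>: "\<pi> \<in> R" "\<forall>\<pi>'\<in>R. \<pi>' \<noteq> \<pi> \<longrightarrow> (\<pi>, \<pi>') \<notin> ?L"
      by blast
    \<comment> \<open>Maximality was obtained only against other runs; irreflexivity covers
      \<open>\<pi>' = \<pi>\<close>.\<close>
    have max: "(\<pi>, \<pi>') \<notin> ?L" if "\<pi>' \<in> R" for \<pi>'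
      using \<pi>(2) that irreflD[OF irrefl_run_less, of \<pi> "up_sim A W"] by (cases "\<pi>' = \<pi>") simp_all
    \<comment> \<open>Otherwise \<open>pruned_run_not_maximal\<close> yields a member of
      \<open>R\<close> strictly above \<open>\<pi>\<close>.\<close>
    have "run (prune A ?P) t \<pi>"
      using pruned_run_not_maximal[OF assms(1,2) t, of \<pi>] \<pi>(1) max unfolding R_def by blast
    moreover have "[] \<in> dom t"
      using t Nil_in_dom_tree unfolding closed_trees_def by blast
    then have "[] \<in> dom \<pi>" using dom(1)[OF \<pi>(1)] by blast
    then have "\<pi> [] = Some (the (\<pi> []))" by auto
    ultimately have "run_from (prune A ?P) t (the (\<pi> [])) \<pi>" by (simp add: run_from_def)
    moreover have "the (\<pi> []) \<in> initial (prune A ?P)" using \<pi>(1) by (simp add: R_def prune_def)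
    moreover have "t \<in> trees (alphabet (prune A ?P)) (rank (prune A ?P))"
        "closed_tree (rank (prune A ?P)) t"
      using t by (simp_all add: closed_trees_def prune_def)
    ultimately show ?thesis unfolding lang_def by blast
  qed
  with lang_prune_subset show ?thesis unfolding good_for_pruning_def by blast
qed

end
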